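(* For all positive integers $m,d,t$, $$O\chi(L(m^2,d,t^2))\leq \begin{cases} t^2(d+1)^2 & \text{if } m\leq t(d+1),\\ (t(d+1)+1)^2 & \text{if } t(d+1)<m\leq t(d+1)^2,\\ \left(\lceil\sqrt{mt}\,\rceil\right)^2 & \text{otherwise.}\end{cases}$$
   Context: Orthogonal colouring: two proper vertex colourings $c_1,c_2$ of a graph $G$ are orthogonal if any two distinct vertices that receive the same colour in one colouring receive distinct colours in the other (equivalently, $v\mapsto (c_1(v),c_2(v))$ is injective). An orthogonal colouring is a pair of orthogonal proper colourings. The orthogonal chromatic number $O\chi(G)$ is the minimum $k$ such that $G$ has an orthogonal colouring in which both colourings use colours from a common set of $k$ colours. The graph $H(m,d,t)$ has vertices $v_i^j$ for $0\leq i<m$, $0\leq j<t$, and two distinct vertices $v_{i_1}^{j_1}$, $v_{i_2}^{j_2}$ are adjacent if and only if $|i_1-i_2|\leq d$. The clique grid graph $L(m^2,d,t^2)$ is the strong product $H(m,d,t)\boxtimes H(m,d,t)$. Equivalently, it consists of $m^2$ disjoint cliques $C_{i,j}$ ($i,j$ ranging over $m$ consecutive integers), each of size $t^2$, where all vertices of $C_{i_1,j_1}$ are adjacent to all vertices of $C_{i_2,j_2}$ (for $(i_1,j_1)\ne(i_2,j_2)$) if $|i_1-i_2|\leq d$ and $|j_1-j_2|\leq d$, and there are no edges between them otherwise. *)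

theory Defs
  imports Complex_Main "Graph_Theory.Pair_Digraph"
begin

text \<open>
  Finite simple graphs are rendered as instances of \<^locale>\<open>pair_graph\<close>: finite vertex set, and
  every edge \<open>uv\<close> represented by the two arcs \<open>(u, v)\<close> and \<open>(v, u)\<close>, without loops.
\<close>

definition proper_colouring :: "'a pair_pre_digraph \<Rightarrow> ('a \<Rightarrow> 'c) \<Rightarrow> bool" where
  "proper_colouring G c \<longleftrightarrow> (\<forall>(u, v) \<in> parcs G. c u \<noteq> c v)"

definition orthogonal_colouring ::
    "'a pair_pre_digraph \<Rightarrow> ('a \<Rightarrow> 'c) \<Rightarrow> ('a \<Rightarrow> 'c) \<Rightarrow> bool" where
  "orthogonal_colouring G c\<^sub>1 c\<^sub>2 \<longleftrightarrow>
     proper_colouring G c\<^sub>1 \<and> proper_colouring G c\<^sub>2 \<and>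
     (\<forall>u \<in> pverts G. \<forall>v \<in> pverts G. u \<noteq> v \<longrightarrow>
        (c\<^sub>1 u = c\<^sub>1 v \<longrightarrow> c\<^sub>2 u \<noteq> c\<^sub>2 v) \<and> (c\<^sub>2 u = c\<^sub>2 v \<longrightarrow> c\<^sub>1 u \<noteq> c\<^sub>1 v))"

lemma orthogonal_colouring_iff_inj_on:
  "orthogonal_colouring G c\<^sub>1 c\<^sub>2 \<longleftrightarrow>
     proper_colouring G c\<^sub>1 \<and> proper_colouring G c\<^sub>2 \<and> inj_on (\<lambda>v. (c\<^sub>1 v, c\<^sub>2 v)) (pverts G)"
  unfolding orthogonal_colouring_def inj_on_def by auto

definition orthogonally_colourable :: "'a pair_pre_digraph \<Rightarrow> nat \<Rightarrow> bool" where
  "orthogonally_colourable G k \<longleftrightarrow>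
     (\<exists>c\<^sub>1 c\<^sub>2 :: 'a \<Rightarrow> nat. orthogonal_colouring G c\<^sub>1 c\<^sub>2 \<and>
        c\<^sub>1 ` pverts G \<subseteq> {..<k} \<and> c\<^sub>2 ` pverts G \<subseteq> {..<k})"

definition orthogonal_chromatic_number :: "'a pair_pre_digraph \<Rightarrow> nat" where
  "orthogonal_chromatic_number G = (LEAST k. orthogonally_colourable G k)"

text \<open>For finite simple graphs the minimum in the previous definition exists.\<close>

lemma (in pair_graph) orthogonally_colourable_chromatic_number:
  "orthogonally_colourable G (orthogonal_chromatic_number G)"
proof -
  obtain f :: "'a \<Rightarrow> nat" and n where f: "f ` pverts G = {i. i < n}" "inj_on f (pverts G)"
    using finite_imp_inj_to_nat_seg[OF finite_verts] by auto
  have "proper_colouring G f"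
    unfolding proper_colouring_def
  proof clarify
    fix u v assume uv: "(u, v) \<in> parcs G" "f u = f v"
    then have "u \<in> pverts G" "v \<in> pverts G" "u \<noteq> v"
      using wellformed[OF uv(1)] no_loops[OF uv(1)] by auto
    then show False using f(2) uv(2) by (auto dest: inj_onD)
  qed
  then have "orthogonally_colourable G n"
    using f unfolding orthogonally_colourable_def orthogonal_colouring_iff_inj_on
    by (intro exI[of _ f]) (auto simp: inj_on_def)
  then show ?thesis unfolding orthogonal_chromatic_number_def by (rule LeastI)
qed

definition strong_product ::
    "'a pair_pre_digraph \<Rightarrow> 'b pair_pre_digraph \<Rightarrow> ('a \<times> 'b) pair_pre_digraph" where
  "strong_product G G' =
     \<lparr> pverts = pverts G \<times> pverts G',
       parcs = {((u, u'), (v, v')) | u u' v v'.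
         u \<in> pverts G \<and> v \<in> pverts G \<and> u' \<in> pverts G' \<and> v' \<in> pverts G' \<and>
         (u, u') \<noteq> (v, v') \<and>
         (u = v \<or> (u, v) \<in> parcs G) \<and> (u' = v' \<or> (u', v') \<in> parcs G')} \<rparr>"

text \<open>The vertex \<open>v\<^sub>i\<^sup>j\<close> of \<open>H(m,d,t)\<close> is the pair \<open>(i, j)\<close>.\<close>

definition H_graph :: "nat \<Rightarrow> nat \<Rightarrow> nat \<Rightarrow> (nat \<times> nat) pair_pre_digraph" where
  "H_graph m d t =
     \<lparr> pverts = {..<m} \<times> {..<t},
       parcs = {((i\<^sub>1, j\<^sub>1), (i\<^sub>2, j\<^sub>2)) | i\<^sub>1 j\<^sub>1 i\<^sub>2 j\<^sub>2.
         i\<^sub>1 < m \<and> j\<^sub>1 < t \<and> i\<^sub>2 < m \<and> j\<^sub>2 < t \<and>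
         (i\<^sub>1, j\<^sub>1) \<noteq> (i\<^sub>2, j\<^sub>2) \<and> \<bar>int i\<^sub>1 - int i\<^sub>2\<bar> \<le> int d} \<rparr>"

text \<open>
  \<open>clique_grid m d t\<close> is \<open>L(m\<^sup>2,d,t\<^sup>2)\<close>: the parameters are \<open>m\<close> and \<open>t\<close>, not their squares.
  The clique \<open>C\<^sub>i\<^sub>,\<^sub>j\<close> consists of the vertices \<open>((i, a), (j, b))\<close> with \<open>a, b < t\<close>.
\<close>

definition clique_grid ::
    "nat \<Rightarrow> nat \<Rightarrow> nat \<Rightarrow> ((nat \<times> nat) \<times> (nat \<times> nat)) pair_pre_digraph" where
  "clique_grid m d t = strong_product (H_graph m d t) (H_graph m d t)"

lemma clique_grid_arc_iff:
  "(((i\<^sub>1, a\<^sub>1), (j\<^sub>1, b\<^sub>1)), ((i\<^sub>2, a\<^sub>2), (j\<^sub>2, b\<^sub>2))) \<in> parcs (clique_grid m d t) \<longleftrightarrow>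
     ((i\<^sub>1, a\<^sub>1), (j\<^sub>1, b\<^sub>1)) \<in> pverts (clique_grid m d t) \<and>
     ((i\<^sub>2, a\<^sub>2), (j\<^sub>2, b\<^sub>2)) \<in> pverts (clique_grid m d t) \<and>
     ((i\<^sub>1, a\<^sub>1), (j\<^sub>1, b\<^sub>1)) \<noteq> ((i\<^sub>2, a\<^sub>2), (j\<^sub>2, b\<^sub>2)) \<and>
     \<bar>int i\<^sub>1 - int i\<^sub>2\<bar> \<le> int d \<and> \<bar>int j\<^sub>1 - int j\<^sub>2\<bar> \<le> int d"
  unfolding clique_grid_def strong_product_def H_graph_def by auto

lemma pair_graph_strong_product:
  assumes "pair_graph G" "pair_graph G'"
  shows "pair_graph (strong_product G G')"
proof -
  interpret G: pair_graph G by fact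
  interpret G': pair_graph G' by fact
  have sym: "(v, u) \<in> parcs G" if "(u, v) \<in> parcs G" for u v
    using that by (rule G.arcs_symmetric)
  have sym': "(v, u) \<in> parcs G'" if "(u, v) \<in> parcs G'" for u v
    using that by (rule G'.arcs_symmetric)
  let ?P = "strong_product G G'"
  have fin: "finite (pverts ?P)"
    by (simp add: strong_product_def)
  have "parcs ?P \<subseteq> pverts ?P \<times> pverts ?P"
    by (auto simp: strong_product_def)
  then have "finite (parcs ?P)"
    using fin finite_subset by blast
  with fin show ?thesis
    by unfold_locales (auto simp: strong_product_def symmetric_def intro!: symI dest: sym sym')
qed

lemma pair_graph_H_graph: "pair_graph (H_graph m d t)"
proof -
  have fin: "finite (pverts (H_graph m d t))"
    by (simp add: H_graph_def)
  have "parcs (H_graph m d t) \<subseteq> pverts (H_graph m d t) \<times> pverts (H_graph m d t)"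
    by (auto simp: H_graph_def)
  then have "finite (parcs (H_graph m d t))"
    using fin finite_subset by blast
  with fin show ?thesis
    by unfold_locales (auto simp: H_graph_def symmetric_def intro!: symI)
qed

lemma pair_graph_clique_grid: "pair_graph (clique_grid m d t)"
  unfolding clique_grid_def by (intro pair_graph_strong_product pair_graph_H_graph)

end

theory Submission
  imports Defs
begin

text \<open>
  Colouring a strong product by pairs of colours shows that the orthogonal chromatic number is
  submultiplicative, so it suffices to colour the factor \<open>H(m,d,t)\<close> with \<open>k\<close> colours, where \<open>k\<^sup>2\<close>
  is the claimed bound. Two colourings are given, according to the size of \<open>m\<close>.

  If \<open>m \<le> t(d+1)\<close>, then \<open>k = t(d+1)\<close> colours are used. The colours come in \<open>d + 1\<close> groups of
  size \<open>t\<close>, and both colourings give the clique \<open>i\<close> the group \<open>i mod (d + 1)\<close>. Inside its group the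
  second colouring is rotated by \<open>i div (d + 1)\<close>; this number is below \<open>t\<close>, so the rotation can be
  recovered from the two colours.

  In the other two cases the bound \<open>k\<close> satisfies \<open>k > t(d+1)\<close> and \<open>k\<^sup>2 \<ge> mt\<close>. Listing the
  vertices clique by clique, adjacent ones are fewer than \<open>t(d+1)\<close> places apart, and so fewer than
  \<open>k - 1\<close>. The vertex at place \<open>x\<close> gets the colours \<open>x mod k\<close> and \<open>(x + x div k) mod k\<close>. The
  first one repeats only at distance \<open>k\<close>. The second one skips one colour at each multiple of \<open>k\<close>,
  so that it repeats no earlier than at distance \<open>k - 1\<close>. The two colours determine \<open>x mod k\<close> and
  \<open>x div k\<close>, since \<open>x div k < k\<close> for all \<open>x < k\<^sup>2\<close>.
\<close>

lemma mixed_radix_less: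
  fixes a b k l :: nat
  assumes "a < k" "b < l"
  shows "a * l + b < k * l"
proof -
  have "a * l + b < Suc a * l" using assms by simp
  also have "\<dots> \<le> k * l" using assms by (intro mult_le_mono1) simp
  finally show ?thesis .
qed

lemma mixed_radix_inject:
  fixes a b a' b' l :: nat
  assumes "b < l" "b' < l"
  shows "a * l + b = a' * l + b' \<longleftrightarrow> a = a' \<and> b = b'"
proof
  assume eq: "a * l + b = a' * l + b'"
  have "(a * l + b) div l = a" "(a' * l + b') div l = a'"
    using assms by simp_all
  with eq show "a = a' \<and> b = b'" by auto
qed auto

lemma mod_eq_imp_eq_of_near:
  fixes x y k :: nat
  assumes "x mod k = y mod k" "x < y + k" "y < x + k"
  shows "x = y"
proof -
  have "int k dvd int x - int y"
    using assms(1) by (metis mod_eq_dvd_iff of_nat_mod)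
  moreover have "\<bar>int x - int y\<bar> < int k"
    using assms by linarith
  ultimately show ?thesis
    using zdvd_imp_le[of "int k" "\<bar>int x - int y\<bar>"] by (cases "x = y") auto
qed

text \<open>
  Concatenating the colours of the two factors as digits turns colour equality in the product into
  colour equality in both factors.
\<close>

lemma orthogonally_colourable_strong_product:
  assumes "orthogonally_colourable G k" and "orthogonally_colourable G' l"
  shows "orthogonally_colourable (strong_product G G') (k * l)"
proof -
  obtain c1 c2 where c: "proper_colouring G c1" "proper_colouring G c2"
      "inj_on (\<lambda>v. (c1 v, c2 v)) (pverts G)"
      "c1 ` pverts G \<subseteq> {..<k}" "c2 ` pverts G \<subseteq> {..<k}"
    using assms(1) unfolding orthogonally_colourable_def orthogonal_colouring_iff_inj_on by blast
  obtain e1 e2 where e: "proper_colouring G' e1" "proper_colouring G' e2"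
      "inj_on (\<lambda>v. (e1 v, e2 v)) (pverts G')"
      "e1 ` pverts G' \<subseteq> {..<l}" "e2 ` pverts G' \<subseteq> {..<l}"
    using assms(2) unfolding orthogonally_colourable_def orthogonal_colouring_iff_inj_on by blast
  define f where "f c e = (\<lambda>(u, u'). c u * l + e u')"
    for c :: "'a \<Rightarrow> nat" and e :: "'b \<Rightarrow> nat"
  have f_eq: "f c e (u, u') = f c e (v, v') \<longleftrightarrow> c u = c v \<and> e u' = e v'"
    if "e ` pverts G' \<subseteq> {..<l}" "u' \<in> pverts G'" "v' \<in> pverts G'" for c e u u' v v'
    using that unfolding f_def by (auto simp: mixed_radix_inject image_subset_iff)
  have bounded: "f c e ` pverts (strong_product G G') \<subseteq> {..<k * l}"
    if "c ` pverts G \<subseteq> {..<k}" "e ` pverts G' \<subseteq> {..<l}" for c e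
    using that unfolding f_def strong_product_def
    by (auto simp: image_subset_iff intro!: mixed_radix_less)
  have proper: "proper_colouring (strong_product G G') (f c e)"
    if "proper_colouring G c" "proper_colouring G' e" "e ` pverts G' \<subseteq> {..<l}" for c e
    using that(1,2) f_eq[OF that(3)] unfolding proper_colouring_def strong_product_def
    by auto
  have "inj_on (\<lambda>v. (f c1 e1 v, f c2 e2 v)) (pverts (strong_product G G'))"
    using c(3) e(3) f_eq[OF e(4)] f_eq[OF e(5)]
    unfolding inj_on_def strong_product_def by auto
  then show ?thesis
    unfolding orthogonally_colourable_def orthogonal_colouring_iff_inj_on
    using proper[OF c(1) e(1,4)] proper[OF c(2) e(2,5)] bounded[OF c(4) e(4)] bounded[OF c(5) e(5)]
    by blast
qed

text \<open>
  Cliques with the same index modulo \<open>d + 1\<close> use the same group of \<open>t\<close> colours in both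
  colourings. There are at most \<open>t\<close> such cliques, one for each rotation of the group.
\<close>

lemma H_graph_colourable_by_rotation:
  assumes "m \<le> t * (d + 1)"
  shows "orthogonally_colourable (H_graph m d t) (t * (d + 1))"
proof -
  define c where "c s = (\<lambda>(i, j). (i mod (d + 1)) * t + (j + s * (i div (d + 1))) mod t)"
    for s :: nat
  have c_eq: "c s (i, j) = c s (i', j') \<longleftrightarrow> i mod (d + 1) = i' mod (d + 1) \<and>
      (j + s * (i div (d + 1))) mod t = (j' + s * (i' div (d + 1))) mod t"
    if "j < t" for s i j i' j'
    using that unfolding c_def by (auto simp: mixed_radix_inject)
  have bounded: "c s ` pverts (H_graph m d t) \<subseteq> {..<t * (d + 1)}" for s
  proof -
    have "(i mod (d + 1)) * t + (j + s * (i div (d + 1))) mod t < (d + 1) * t" if "j < t" for i j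
      using that by (intro mixed_radix_less) auto
    then show ?thesis
      unfolding c_def H_graph_def by (auto simp: mult.commute[of t])
  qed
  have proper: "proper_colouring (H_graph m d t) (c s)" for s
  proof -
    have "c s (i, j) \<noteq> c s (i', j')"
      if "j < t" "j' < t" "(i, j) \<noteq> (i', j')" "\<bar>int i - int i'\<bar> \<le> int d" for i j i' j'
    proof
      assume eq: "c s (i, j) = c s (i', j')"
      have "i = i'"
        using eq that by - (rule mod_eq_imp_eq_of_near[where k = "d + 1"], auto simp: c_eq)
      moreover from this have "j + s * (i div (d + 1)) = j' + s * (i' div (d + 1))"
        using eq that by - (rule mod_eq_imp_eq_of_near[where k = t], auto simp: c_eq)
      ultimately show False using that(3) by simp
    qed
    then show ?thesis unfolding proper_colouring_def H_graph_def by auto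
  qed
  have "inj_on (\<lambda>v. (c 0 v, c 1 v)) (pverts (H_graph m d t))"
  proof (rule inj_onI, clarify)
    fix i j i' j'
    assume v: "(i, j) \<in> pverts (H_graph m d t)" "(i', j') \<in> pverts (H_graph m d t)"
      and eq: "c 0 (i, j) = c 0 (i', j')" "c 1 (i, j) = c 1 (i', j')"
    have b: "i < m" "i' < m" "j < t" "j' < t"
      using v by (auto simp: H_graph_def)
    have j: "j = j'" and r: "i mod (d + 1) = i' mod (d + 1)"
      using eq(1) b by (auto simp: c_eq)
    have "i div (d + 1) < t" "i' div (d + 1) < t"
      using b assms by (auto intro!: less_mult_imp_div_less)
    then have "j + i div (d + 1) = j' + i' div (d + 1)"
      using eq(2) b j by - (rule mod_eq_imp_eq_of_near[where k = t], auto simp: c_eq)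
    then show "i = i' \<and> j = j'"
      using j r by (metis add_left_cancel div_mult_mod_eq)
  qed
  then show ?thesis
    unfolding orthogonally_colourable_def orthogonal_colouring_iff_inj_on
    using proper bounded by blast
qed

text \<open>
  On an interval of fewer than \<open>k\<close> steps \<open>x div k\<close> grows by at most one, so a total growth of \<open>k\<close>
  in \<open>x + x div k\<close> takes at least \<open>k - 1\<close> steps.
\<close>

lemma skipping_residues_distinct:
  fixes x y k :: nat
  assumes "x < y" "y + 1 < x + k"
  shows "(x + x div k) mod k \<noteq> (y + y div k) mod k"
proof
  assume eq: "(x + x div k) mod k = (y + y div k) mod k"
  have "y div k \<le> (x + k) div k"
    using assms by (intro div_le_mono) simp
  then have "y div k \<le> x div k + 1"
    using assms by (cases "k = 0") auto
  moreover have "x div k \<le> y div k"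
    using assms by (intro div_le_mono) simp
  ultimately have "x + x div k = y + y div k"
    using assms by - (rule mod_eq_imp_eq_of_near[OF eq], linarith+)
  with \<open>x div k \<le> y div k\<close> assms(1) show False by simp
qed

lemma residue_and_skipping_residue_inject:
  fixes x y k :: nat
  assumes "x < k * k" "y < k * k" "x mod k = y mod k"
    and "(x + x div k) mod k = (y + y div k) mod k"
  shows "x = y"
proof -
  have lt: "x div k < k" "y div k < k"
    using assms by (auto intro: less_mult_imp_div_less)
  have "(x mod k + x div k) mod k = (y mod k + y div k) mod k"
    using assms(4) by (simp add: mod_add_left_eq)
  then have "x mod k + x div k = y mod k + y div k"
    using lt assms(3) by - (rule mod_eq_imp_eq_of_near[where k = k], auto)
  then show ?thesis
    using assms(3) by (metis add_left_cancel div_mult_mod_eq)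
qed

text \<open>
  Two vertices whose cliques are at most \<open>d\<close> apart are at most \<open>dt + (t - 1)\<close> places apart, which is
  where \<open>t * (d + 1) < k\<close> makes both colourings proper. The bound \<open>m * t \<le> k * k\<close> keeps all
  places below \<open>k * k\<close>, where the pair of colours identifies the place.
\<close>

lemma H_graph_colourable_by_skipping:
  assumes "t * (d + 1) < k" and "m * t \<le> k * k"
  shows "orthogonally_colourable (H_graph m d t) k"
proof -
  define p where "p = (\<lambda>(i, j). i * t + j)"
  define c1 where "c1 = (\<lambda>v. p v mod k)"
  define c2 where "c2 = (\<lambda>v. (p v + p v div k) mod k)"
  have p_inj: "p (i, j) = p (i', j') \<longleftrightarrow> (i, j) = (i', j')" if "j < t" "j' < t" for i j i' j'
    using that by (simp add: p_def mixed_radix_inject)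
  have p_less: "p v < k * k" if v: "v \<in> pverts (H_graph m d t)" for v
  proof -
    obtain i j where "v = (i, j)" "i < m" "j < t"
      using v by (auto simp: H_graph_def)
    then have "p v < m * t" by (simp add: p_def mixed_radix_less)
    with assms(2) show ?thesis by simp
  qed
  have near: "p (i', j') + 1 < p (i, j) + k"
    if "j < t" "j' < t" "i' \<le> i + d" for i j i' j'
  proof -
    have "i' * t \<le> (i + d) * t" using that(3) by (rule mult_le_mono1)
    then show ?thesis
      using that assms(1) by (simp add: p_def algebra_simps)
  qed
  have "c1 (i, j) \<noteq> c1 (i', j') \<and> c2 (i, j) \<noteq> c2 (i', j')"
    if "j < t" "j' < t" "(i, j) \<noteq> (i', j')" "\<bar>int i - int i'\<bar> \<le> int d" for i j i' j'
  proof -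
    have ne: "p (i, j) \<noteq> p (i', j')" using p_inj that by blast
    have n: "p (i', j') + 1 < p (i, j) + k" "p (i, j) + 1 < p (i', j') + k"
      using near that by auto
    have "c1 (i, j) \<noteq> c1 (i', j')"
      using mod_eq_imp_eq_of_near[of "p (i, j)" k "p (i', j')"] ne n by (auto simp: c1_def)
    moreover have "c2 (i, j) \<noteq> c2 (i', j')"
      using skipping_residues_distinct[of "p (i, j)" "p (i', j')" k]
        skipping_residues_distinct[of "p (i', j')" "p (i, j)" k] ne n
      unfolding c2_def by (metis nat_neq_iff)
    ultimately show ?thesis ..
  qed
  then have "proper_colouring (H_graph m d t) c1" "proper_colouring (H_graph m d t) c2"
    unfolding proper_colouring_def H_graph_def by auto
  moreover have "inj_on (\<lambda>v. (c1 v, c2 v)) (pverts (H_graph m d t))"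
  proof (rule inj_onI)
    fix u v
    assume uv: "u \<in> pverts (H_graph m d t)" "v \<in> pverts (H_graph m d t)"
      and "(c1 u, c2 u) = (c1 v, c2 v)"
    then have "p u = p v"
      using residue_and_skipping_residue_inject[OF p_less p_less, of u v]
      by (simp add: c1_def c2_def)
    then show "u = v"
      using uv p_inj by (auto simp: H_graph_def)
  qed
  moreover have "c1 ` pverts (H_graph m d t) \<subseteq> {..<k}" "c2 ` pverts (H_graph m d t) \<subseteq> {..<k}"
    using assms(1) by (auto simp: c1_def c2_def)
  ultimately show ?thesis
    unfolding orthogonally_colourable_def orthogonal_colouring_iff_inj_on by blast
qed

lemma chromatic_number_clique_grid_le:
  assumes "orthogonally_colourable (H_graph m d t) k"
  shows "orthogonal_chromatic_number (clique_grid m d t) \<le> k ^ 2"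
  using orthogonally_colourable_strong_product[OF assms assms]
  unfolding orthogonal_chromatic_number_def clique_grid_def power2_eq_square
  by (rule Least_le)

theorem corollary2p3:
  fixes m d t :: nat
  assumes "m > 0" and "d > 0" and "t > 0"
  shows "orthogonal_chromatic_number (clique_grid m d t) \<le>
    (if m \<le> t * (d + 1) then t ^ 2 * (d + 1) ^ 2
     else if m \<le> t * (d + 1) ^ 2 then (t * (d + 1) + 1) ^ 2
     else (nat \<lceil>sqrt (real m * real t)\<rceil>) ^ 2)"
proof -
  have small: "orthogonal_chromatic_number (clique_grid m d t) \<le> t ^ 2 * (d + 1) ^ 2"
    if "m \<le> t * (d + 1)"
    using chromatic_number_clique_grid_le[OF H_graph_colourable_by_rotation[OF that]]
    by (simp only: power_mult_distrib)
  have medium: "orthogonal_chromatic_number (clique_grid m d t) \<le> (t * (d + 1) + 1) ^ 2"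
    if "m \<le> t * (d + 1) ^ 2"
  proof -
    have "m * t \<le> t * (d + 1) ^ 2 * t" using that by (rule mult_le_mono1)
    also have "\<dots> = (t * (d + 1)) * (t * (d + 1))"
      by (simp only: power2_eq_square mult_ac)
    also have "\<dots> \<le> (t * (d + 1) + 1) * (t * (d + 1) + 1)"
      by (intro mult_le_mono) auto
    finally show ?thesis
      by (intro chromatic_number_clique_grid_le H_graph_colourable_by_skipping) auto
  qed
  have large: "orthogonal_chromatic_number (clique_grid m d t)
      \<le> (nat \<lceil>sqrt (real m * real t)\<rceil>) ^ 2" if "t * (d + 1) ^ 2 < m"
  proof -
    define k where "k = nat \<lceil>sqrt (real m * real t)\<rceil>"
    have "sqrt (real m * real t) \<le> real k"
      unfolding k_def by (rule real_nat_ceiling_ge)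
    then have "real m * real t \<le> (real k)\<^sup>2"
      by (rule sqrt_le_D)
    then have "real (m * t) \<le> real (k * k)"
      by (simp add: power2_eq_square)
    then have mt: "m * t \<le> k * k"
      by (simp only: of_nat_le_iff)
    have "(t * (d + 1)) ^ 2 = t * (d + 1) ^ 2 * t"
      by (simp only: power2_eq_square mult_ac)
    also have "\<dots> < m * t"
      using that assms(3) by (rule mult_less_mono1)
    also have "\<dots> \<le> k ^ 2"
      using mt by (simp add: power2_eq_square)
    finally have "t * (d + 1) < k"
      by (rule power_less_imp_less_base) simp
    then show ?thesis
      unfolding k_def[symmetric] using mt
      by (intro chromatic_number_clique_grid_le H_graph_colourable_by_skipping)
  qed
  show ?thesis
    using small medium large by simp
qed

end
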